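(* Let $G$ be a connected graph and let $A, B$ be two disjoint, linked and saturated subsets of $V(G)$. Then $A$ and $B$ are separable if and only if the following two conditions hold: (1) for every $v \in V(G)\setminus(A \cup B)$, the equivalence class $[v]_{AB}$ contains no forbidden pair, i.e., there are no $x, y \in [v]_{AB}$ with $\{x,y\} \in \mathrm{mfs}(A,B)$; (2) the graph $G_{AB}$ is bipartite.
   Context: All graphs are finite, undirected and loopless. For $X \subseteq V(G)$, $N(X) = \{u \in V(G)\setminus X : u \text{ is adjacent to some } x \in X\}$, $N[X] = N(X) \cup X$, and $G - X$ is the subgraph induced by $V(G)\setminus X$. A chordless $uv$-path is a $uv$-path that is an induced subgraph. A set $C \subseteq V(G)$ is convex (monophonically convex) if for all $u,v \in C$ every vertex on a chordless $uv$-path lies in $C$. For $X \subseteq V(G)$, $\mathrm{cl}(X)$ is the intersection of all convex sets containing $X$. A half-space is a convex set $H$ with $V(G)\setminus H$ convex; $A$ and $B$ are separable if there is a half-space $H$ with $A \subseteq H$ and $B \subseteq V(G)\setminus H$. $A$ and $B$ are linked if some $a \in A$ is adjacent to some $b \in B$. The shadow of $A$ with respect to $B$ is $A/B = \{v \in V(G) : \mathrm{cl}(B \cup \{v\}) \cap A \neq \emptyset\}$. A set $X \subseteq V(G)\setminus(A\cup B)$ is forbidden (for $A,B$) if $\mathrm{cl}(X)\cap A \ne \emptyset$ and $\mathrm{cl}(X) \cap B \neq \emptyset$; $\mathrm{mfs}(A,B)$ is the family of inclusion-wise minimal forbidden sets, and a forbidden pair is a two-element member of $\mathrm{mfs}(A,B)$.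 The pre-saturation is $\sigma(A,B) = \mathrm{cl}\big(A/B \cup \bigcup\{\bigcap_{x \in X}\mathrm{cl}(A \cup \{x\}) : X \in \mathrm{mfs}(A,B)\}\big)$. The saturation is $S(A,B) = \bigcup_{i\ge 0}\sigma(A_i,B_i)$ where $A_0=A$, $B_0=B$, $A_i = \sigma(A_{i-1},B_{i-1})$, $B_i = \sigma(B_{i-1},A_{i-1})$; $A,B$ are saturated if $A = S(A,B)$ and $B = S(B,A)$. An intersecting sequence is a sequence $S_1,\dots,S_k$ of (not necessarily distinct) connected components of $G - N[A\cup B]$ with $N(S_i)\cap N(S_{i+1}) \neq \emptyset$ for $1 \le i < k$; vertices $u,v$ belong to it if $u \in N[S_i]$ and $v \in N[S_j]$ for some $i,j$. On $V(G)\setminus(A\cup B)$ define $u \equiv_{AB} v$ iff $u = v$ or $u, v$ belong to a common intersecting sequence; this is an equivalence relation and $[v]_{AB}$ denotes the class of $v$. The graph $G_{AB}$ has as vertices the equivalence classes of $\equiv_{AB}$, and two classes $[u]_{AB}, [v]_{AB}$ are adjacent iff $u \not\equiv_{AB} v$ and $\{u,v\} \in \mathrm{mfs}(A,B)$. *)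

theory Defs
  imports "Graph_Theory.Digraph_Component_Vwalk"
begin

text \<open>
  Undirected graphs are symmetric digraphs, as in \<^theory>\<open>Graph_Theory.Digraph\<close>.
  All notions below depend only on the vertex set and the adjacency relation
  \<^const>\<open>dominates\<close>, so parallel arcs are harmless.
\<close>

definition nbhd :: "('a, 'b) pre_digraph \<Rightarrow> 'a set \<Rightarrow> 'a set" where
  "nbhd G X = {u \<in> verts G - X. \<exists>x\<in>X. u \<rightarrow>\<^bsub>G\<^esub> x}"

definition closed_nbhd :: "('a, 'b) pre_digraph \<Rightarrow> 'a set \<Rightarrow> 'a set" where
  "closed_nbhd G X = nbhd G X \<union> X"


subsection \<open>Monophonic convexity\<close>

text \<open>
  The last conjunct says that the subgraph induced by the vertices of the path
  has no edges other than those of the path.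
\<close>

definition chordless_path :: "('a, 'b) pre_digraph \<Rightarrow> 'a \<Rightarrow> 'a list \<Rightarrow> 'a \<Rightarrow> bool" where
  "chordless_path G u p v \<longleftrightarrow>
     vpath p G \<and> hd p = u \<and> last p = v \<and>
     arcs_ends (G \<restriction> set p) = set (vwalk_arcs p) \<union> (set (vwalk_arcs p))\<inverse>"

definition mono_convex :: "('a, 'b) pre_digraph \<Rightarrow> 'a set \<Rightarrow> bool" where
  "mono_convex G C \<longleftrightarrow>
     C \<subseteq> verts G \<and> (\<forall>u\<in>C. \<forall>v\<in>C. \<forall>p. chordless_path G u p v \<longrightarrow> set p \<subseteq> C)"

definition cl :: "('a, 'b) pre_digraph \<Rightarrow> 'a set \<Rightarrow> 'a set" where
  "cl G X = mono_convex G hull X"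

definition half_space :: "('a, 'b) pre_digraph \<Rightarrow> 'a set \<Rightarrow> bool" where
  "half_space G H \<longleftrightarrow> mono_convex G H \<and> mono_convex G (verts G - H)"

definition separable :: "('a, 'b) pre_digraph \<Rightarrow> 'a set \<Rightarrow> 'a set \<Rightarrow> bool" where
  "separable G A B \<longleftrightarrow> (\<exists>H. half_space G H \<and> A \<subseteq> H \<and> B \<subseteq> verts G - H)"

definition linked :: "('a, 'b) pre_digraph \<Rightarrow> 'a set \<Rightarrow> 'a set \<Rightarrow> bool" where
  "linked G A B \<longleftrightarrow> (\<exists>a\<in>A. \<exists>b\<in>B. a \<rightarrow>\<^bsub>G\<^esub> b)"


subsection \<open>Forbidden sets and saturation\<close>

definition shadow :: "('a, 'b) pre_digraph \<Rightarrow> 'a set \<Rightarrow> 'a set \<Rightarrow> 'a set" where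
  "shadow G A B = {v \<in> verts G. cl G (B \<union> {v}) \<inter> A \<noteq> {}}"

definition forbidden :: "('a, 'b) pre_digraph \<Rightarrow> 'a set \<Rightarrow> 'a set \<Rightarrow> 'a set \<Rightarrow> bool" where
  "forbidden G A B X \<longleftrightarrow>
     X \<subseteq> verts G - (A \<union> B) \<and> cl G X \<inter> A \<noteq> {} \<and> cl G X \<inter> B \<noteq> {}"

definition mfs :: "('a, 'b) pre_digraph \<Rightarrow> 'a set \<Rightarrow> 'a set \<Rightarrow> 'a set set" where
  "mfs G A B = {X. forbidden G A B X \<and> (\<forall>Y. Y \<subset> X \<longrightarrow> \<not> forbidden G A B Y)}"

definition presaturation :: "('a, 'b) pre_digraph \<Rightarrow> 'a set \<Rightarrow> 'a set \<Rightarrow> 'a set" where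
  "presaturation G A B =
     cl G (shadow G A B \<union> (\<Union>X\<in>mfs G A B. \<Inter>x\<in>X. cl G (A \<union> {x})))"

primrec saturation_seq ::
    "('a, 'b) pre_digraph \<Rightarrow> 'a set \<Rightarrow> 'a set \<Rightarrow> nat \<Rightarrow> 'a set \<times> 'a set" where
  "saturation_seq G A B 0 = (A, B)"
| "saturation_seq G A B (Suc i) =
     (let (A', B') = saturation_seq G A B i
      in (presaturation G A' B', presaturation G B' A'))"

definition saturation :: "('a, 'b) pre_digraph \<Rightarrow> 'a set \<Rightarrow> 'a set \<Rightarrow> 'a set" where
  "saturation G A B = (\<Union>i. fst (saturation_seq G A B i))"

definition saturated :: "('a, 'b) pre_digraph \<Rightarrow> 'a set \<Rightarrow> 'a set \<Rightarrow> bool" where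
  "saturated G A B \<longleftrightarrow> A = saturation G A B \<and> B = saturation G B A"


subsection \<open>The quotient graph\<close>

text \<open>
  Since the graphs considered are symmetric, the strongly connected components
  are the connected components. Components are represented by their vertex sets.
\<close>

definition far_components :: "('a, 'b) pre_digraph \<Rightarrow> 'a set \<Rightarrow> 'a set \<Rightarrow> 'a set set" where
  "far_components G A B =
     pre_digraph.sccs_verts (G \<restriction> (verts G - closed_nbhd G (A \<union> B)))"

definition intersecting_seq ::
    "('a, 'b) pre_digraph \<Rightarrow> 'a set \<Rightarrow> 'a set \<Rightarrow> 'a set list \<Rightarrow> bool" where
  "intersecting_seq G A B Ss \<longleftrightarrow>
     set Ss \<subseteq> far_components G A B \<and>
     (\<forall>i. Suc i < length Ss \<longrightarrow> nbhd G (Ss ! i) \<inter> nbhd G (Ss ! Suc i) \<noteq> {})"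

definition belongs_to :: "('a, 'b) pre_digraph \<Rightarrow> 'a \<Rightarrow> 'a set list \<Rightarrow> bool" where
  "belongs_to G u Ss \<longleftrightarrow> (\<exists>S\<in>set Ss. u \<in> closed_nbhd G S)"

definition equiv_rel :: "('a, 'b) pre_digraph \<Rightarrow> 'a set \<Rightarrow> 'a set \<Rightarrow> 'a rel" where
  "equiv_rel G A B =
     {(u, v). u \<in> verts G - (A \<union> B) \<and> v \<in> verts G - (A \<union> B) \<and>
       (u = v \<or> (\<exists>Ss. intersecting_seq G A B Ss \<and> belongs_to G u Ss \<and> belongs_to G v Ss))}"

definition equiv_class :: "('a, 'b) pre_digraph \<Rightarrow> 'a set \<Rightarrow> 'a set \<Rightarrow> 'a \<Rightarrow> 'a set" where
  "equiv_class G A B v = equiv_rel G A B `` {v}"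

text \<open>Two classes are adjacent if some pair of representatives is a forbidden pair.\<close>

definition quotient_graph ::
    "('a, 'b) pre_digraph \<Rightarrow> 'a set \<Rightarrow> 'a set \<Rightarrow> 'a set pair_pre_digraph" where
  "quotient_graph G A B =
     \<lparr> pverts = (verts G - (A \<union> B)) // equiv_rel G A B,
       parcs = {(equiv_class G A B u, equiv_class G A B v) | u v.
         u \<in> verts G - (A \<union> B) \<and> v \<in> verts G - (A \<union> B) \<and>
         (u, v) \<notin> equiv_rel G A B \<and> {u, v} \<in> mfs G A B} \<rparr>"

definition bipartite :: "('a, 'b) pre_digraph \<Rightarrow> bool" where
  "bipartite H \<longleftrightarrow> (\<exists>U W. verts H = U \<union> W \<and> U \<inter> W = {} \<and>
     (\<forall>x y. x \<rightarrow>\<^bsub>H\<^esub> y \<longrightarrow> x \<in> U \<and> y \<in> W \<or> x \<in> W \<and> y \<in> U))"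

end

theory Submission
  imports Defs
begin

text \<open>
  Let the rim be the set of vertices outside \<open>A \<union> B\<close> adjacent to \<open>A\<close>. Since \<open>A\<close> and \<open>B\<close> contain their
  shadows, the rim is also the set of outside vertices adjacent to \<open>B\<close>, and the ends of an edge between
  \<open>A\<close> and \<open>B\<close> are adjacent to the whole rim. Hence two nonadjacent rim vertices form a forbidden pair.
  The remaining outside vertices make up the components \<open>S\<close> of \<open>G - N[A \<union> B]\<close>, with \<open>N(S)\<close> in the rim;
  a half-space separating \<open>A\<close> from \<open>B\<close> either contains \<open>N[S]\<close> or is disjoint from it, since \<open>N(S)\<close> lies
  on chordless paths from \<open>S\<close> to the ends of the linking edge. So it is constant on classes and splits
  every forbidden pair.

  Conversely, if some two rim vertices are nonadjacent, saturation forces all rim vertices to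
  have the same neighbours in \<open>A\<close> and the same neighbours in \<open>B\<close>. Then every colouring of the
  outside that is constant on classes and separates nonadjacent rim vertices yields complementary
  half-spaces, and a 2-colouring of \<open>G\<^bsub>AB\<^esub>\<close> is such a colouring. If the rim is a clique, the
  complement of \<open>B\<close> is itself a half-space.
\<close>

unbundle no funcset_syntax

locale undirected_graph = pseudo_graph + loopfree_digraph
begin

lemma adj_sym: "u \<rightarrow> v \<Longrightarrow> v \<rightarrow> u"
  by (rule arcs_ends_symmetric[OF sym_arcs])

subsection \<open>Induced paths\<close>

text \<open>Only positions \<open>i < j\<close> are constrained: symmetry of adjacency covers
  \<open>i > j\<close>, and loop-freeness covers \<open>i = j\<close>.\<close>

definition induced_path :: "'a list \<Rightarrow> bool" where
  "induced_path p \<longleftrightarrow> p \<noteq> [] \<and> set p \<subseteq> verts G \<and> distinct p \<and>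
     (\<forall>j<length p. \<forall>i<j. p ! i \<rightarrow> p ! j \<longleftrightarrow> j = Suc i)"

lemma set_vwalk_arcs:
  "set (vwalk_arcs p) = {(p ! i, p ! Suc i) | i. Suc i < length p}"
proof (induction p rule: vwalk_arcs.induct)
  case (3 x y xs)
  have "{((x # y # xs) ! i, (x # y # xs) ! Suc i) | i. Suc i < length (x # y # xs)} =
      insert (x, y) {((y # xs) ! i, (y # xs) ! Suc i) | i. Suc i < length (y # xs)}"
    (is "?L = insert _ ?R")
  proof
    show "?L \<subseteq> insert (x, y) ?R"
    proof
      fix z assume "z \<in> ?L"
      then obtain i where i: "z = ((x # y # xs) ! i, (x # y # xs) ! Suc i)"
        "Suc i < length (x # y # xs)" by blast
      show "z \<in> insert (x, y) ?R"
        using i by (cases i) auto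
    qed
    show "insert (x, y) ?R \<subseteq> ?L"
    proof
      fix z assume "z \<in> insert (x, y) ?R"
      then show "z \<in> ?L"
      proof
        assume "z = (x, y)"
        then show ?thesis by (auto intro!: exI[of _ 0])
      next
        assume "z \<in> ?R"
        then obtain i where "z = ((y # xs) ! i, (y # xs) ! Suc i)" "Suc i < length (y # xs)"
          by blast
        then show ?thesis by (auto intro!: exI[of _ "Suc i"])
      qed
    qed
  qed
  then show ?case using 3 by simp
qed auto

lemma arcs_ends_induce:
  "arcs_ends (G \<restriction> X) = {(u, v). u \<in> X \<and> v \<in> X \<and> u \<rightarrow> v}"
  by (auto simp: arcs_ends_conv induce_subgraph_def)

text \<open>Distinctness lets each arc of the induced subgraph be read as a pair of positions, which
  turns the equation between arc sets into a condition on indices.\<close>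

lemma chordless_path_iff:
  "chordless_path G u p v \<longleftrightarrow> induced_path p \<and> hd p = u \<and> last p = v"
proof
  assume L: "chordless_path G u p v"
  then have p: "p \<noteq> []" "set p \<subseteq> verts G" "distinct p" "hd p = u" "last p = v"
    and arcs: "arcs_ends (G \<restriction> set p) = set (vwalk_arcs p) \<union> (set (vwalk_arcs p))\<inverse>"
    unfolding chordless_path_def vpath_def vwalk_def by auto
  have "p ! i \<rightarrow> p ! j \<longleftrightarrow> j = Suc i" if "i < j" "j < length p" for i j
  proof -
    have "p ! i \<rightarrow> p ! j \<longleftrightarrow> (p ! i, p ! j) \<in> arcs_ends (G \<restriction> set p)"
      using that by (simp add: arcs_ends_induce)
    also have "\<dots> \<longleftrightarrow> (\<exists>k. Suc k < length p \<and>
        (p ! i = p ! k \<and> p ! j = p ! Suc k \<or> p ! j = p ! k \<and> p ! i = p ! Suc k))"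
      unfolding arcs set_vwalk_arcs by auto
    also have "\<dots> \<longleftrightarrow> j = Suc i"
      using that \<open>distinct p\<close> by (auto simp: nth_eq_iff_index_eq)
    finally show ?thesis .
  qed
  with p show "induced_path p \<and> hd p = u \<and> last p = v"
    by (simp add: induced_path_def)
next
  assume R: "induced_path p \<and> hd p = u \<and> last p = v"
  then have p: "p \<noteq> []" "set p \<subseteq> verts G" "distinct p" "hd p = u" "last p = v"
    and adj: "\<And>i j. i < j \<Longrightarrow> j < length p \<Longrightarrow> p ! i \<rightarrow> p ! j \<longleftrightarrow> j = Suc i"
    by (auto simp: induced_path_def)
  have walk: "set (vwalk_arcs p) \<subseteq> arcs_ends G"
    using adj by (auto simp: set_vwalk_arcs)
  have "(x, y) \<in> set (vwalk_arcs p) \<union> (set (vwalk_arcs p))\<inverse>"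
    if xy: "x \<in> set p" "y \<in> set p" "x \<rightarrow> y" for x y
  proof -
    obtain i j where ij: "x = p ! i" "y = p ! j" "i < length p" "j < length p"
      using xy by (metis in_set_conv_nth)
    consider "i < j" | "i = j" | "j < i" by linarith
    then show ?thesis
    proof cases
      case 1
      then have "j = Suc i" using adj ij xy by blast
      then show ?thesis using ij by (auto simp: set_vwalk_arcs)
    next
      case 2
      then show ?thesis using ij xy adj_not_same by blast
    next
      case 3
      then have "i = Suc j" using adj ij xy adj_sym by blast
      then show ?thesis using ij by (auto simp: set_vwalk_arcs)
    qed
  qed
  moreover have "x \<in> set p \<and> y \<in> set p \<and> x \<rightarrow> y"
    if "(x, y) \<in> set (vwalk_arcs p) \<union> (set (vwalk_arcs p))\<inverse>" for x y
    using that walk adj_sym by (auto simp: set_vwalk_arcs)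
  ultimately have "arcs_ends (G \<restriction> set p) = set (vwalk_arcs p) \<union> (set (vwalk_arcs p))\<inverse>"
    unfolding arcs_ends_induce by blast
  with p walk show "chordless_path G u p v"
    by (auto simp: chordless_path_def)
qed

lemma mono_convexD:
  assumes "mono_convex G C" "induced_path p" "hd p \<in> C" "last p \<in> C"
  shows "set p \<subseteq> C"
  using assms unfolding mono_convex_def chordless_path_iff by blast

lemma cl_path:
  assumes "induced_path p" "hd p \<in> cl G X" "last p \<in> cl G X"
  shows "set p \<subseteq> cl G X"
  using assms mono_convexD unfolding cl_def hull_def by blast

lemma cl_subset: "X \<subseteq> cl G X"
  unfolding cl_def by (rule hull_subset)

lemma cl_minimal: "X \<subseteq> C \<Longrightarrow> mono_convex G C \<Longrightarrow> cl G X \<subseteq> C"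
  unfolding cl_def by (rule hull_minimal)

lemma induced_path_singleton: "v \<in> verts G \<Longrightarrow> induced_path [v]"
  by (simp add: induced_path_def)

lemma induced_path_snoc:
  assumes "induced_path p" "v \<notin> set p" "last p \<rightarrow> v"
    and "\<And>x. x \<in> set (butlast p) \<Longrightarrow> \<not> x \<rightarrow> v"
  shows "induced_path (p @ [v])"
proof -
  have p: "p \<noteq> []" "set p \<subseteq> verts G" "distinct p"
    and adj: "\<And>i j. i < j \<Longrightarrow> j < length p \<Longrightarrow> p ! i \<rightarrow> p ! j \<longleftrightarrow> j = Suc i"
    using assms(1) by (auto simp: induced_path_def)
  have "(p @ [v]) ! i \<rightarrow> (p @ [v]) ! j \<longleftrightarrow> j = Suc i" if "i < j" "j < length (p @ [v])" for i j
  proof (cases "j < length p")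
    case True
    then show ?thesis using that adj by (simp add: nth_append)
  next
    case False
    then have j: "j = length p" using that by simp
    show ?thesis
    proof (cases "Suc i = length p")
      case True
      then have "p ! i = last p" by (metis diff_Suc_1 last_conv_nth p(1))
      then show ?thesis using j True assms(3) by (simp add: nth_append)
    next
      case False
      then have "p ! i \<in> set (butlast p)"
        using that j by (auto simp: in_set_conv_nth nth_butlast intro!: exI[of _ i])
      then show ?thesis using j False that assms(4) by (simp add: nth_append)
    qed
  qed
  then show ?thesis
    using p assms(2,3) adj_in_verts by (auto simp: induced_path_def)
qed

lemma induced_path_slice:
  assumes "induced_path p" "m \<le> k" "k < length p"
  shows "induced_path (drop m (take (Suc k) p))" (is "induced_path ?q")
    and "hd (drop m (take (Suc k) p)) = p ! m"
    and "last (drop m (take (Suc k) p)) = p ! k"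
    and "set (drop m (take (Suc k) p)) = {p ! i | i. m \<le> i \<and> i \<le> k}"
proof -
  have len: "length ?q = Suc k - m" using assms by simp
  have ne: "?q \<noteq> []" using assms by auto
  have nth: "?q ! i = p ! (m + i)" if "i < length ?q" for i
    using that assms by simp
  have adj: "\<And>i j. i < j \<Longrightarrow> j < length p \<Longrightarrow> p ! i \<rightarrow> p ! j \<longleftrightarrow> j = Suc i"
    using assms(1) by (auto simp: induced_path_def)
  have "?q ! i \<rightarrow> ?q ! j \<longleftrightarrow> j = Suc i" if "i < j" "j < length ?q" for i j
    using adj[of "m + i" "m + j"] that assms nth[of i] nth[of j] by auto
  moreover have "set ?q \<subseteq> verts G" "distinct ?q"
    using assms(1) unfolding induced_path_def
    by (meson in_set_dropD in_set_takeD subset_iff, simp add: distinct_drop distinct_take)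
  ultimately show "induced_path ?q" using ne by (simp add: induced_path_def)
  show "hd ?q = p ! m" using ne nth[of 0] len assms by (simp add: hd_conv_nth)
  show "last ?q = p ! k" using ne nth[of "k - m"] len assms by (simp add: last_conv_nth)
  show "set ?q = {p ! i | i. m \<le> i \<and> i \<le> k}"
  proof
    show "set ?q \<subseteq> {p ! i | i. m \<le> i \<and> i \<le> k}"
    proof
      fix x assume "x \<in> set ?q"
      then obtain i where "i < length ?q" "x = ?q ! i" by (metis in_set_conv_nth)
      then show "x \<in> {p ! i | i. m \<le> i \<and> i \<le> k}" using nth[of i] len by force
    qed
    show "{p ! i | i. m \<le> i \<and> i \<le> k} \<subseteq> set ?q"
    proof
      fix x assume "x \<in> {p ! i | i. m \<le> i \<and> i \<le> k}"
      then obtain i where i: "m \<le> i" "i \<le> k" "x = p ! i" by blast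
      then have "x = ?q ! (i - m)" "i - m < length ?q" using nth[of "i - m"] len by auto
      then show "x \<in> set ?q" by (metis nth_mem)
    qed
  qed
qed

text \<open>Induction along the walk: the path found so far is cut at its first vertex that equals
  or sees the next vertex \<open>z\<close>, so that appending \<open>z\<close> creates no
  chord.\<close>

lemma induced_path_of_walk:
  assumes "(x, y) \<in> (Restr (arcs_ends G) X)\<^sup>*" "x \<in> X" "x \<in> verts G"
  obtains p where "induced_path p" "hd p = x" "last p = y" "set p \<subseteq> X"
proof -
  have "\<exists>p. induced_path p \<and> hd p = x \<and> last p = y \<and> set p \<subseteq> X"
    using assms(1)
  proof (induction rule: rtrancl_induct)
    case base
    show ?case using assms induced_path_singleton by (intro exI[of _ "[x]"]) auto
  next
    case (step y z)
    then obtain p where p: "induced_path p" "hd p = x" "last p = y" "set p \<subseteq> X" by blast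
    have ne: "p \<noteq> []" using p(1) by (simp add: induced_path_def)
    have yz: "y \<rightarrow> z" "z \<in> X" using step.hyps by auto
    let ?P = "\<lambda>i. i < length p \<and> (p ! i = z \<or> p ! i \<rightarrow> z)"
    have "?P (length p - 1)" using ne p yz by (auto simp: last_conv_nth)
    then obtain k where k: "?P k" and least: "\<And>i. i < k \<Longrightarrow> \<not> ?P i"
      using exists_least_iff[of ?P] by blast
    then have kl: "k < length p" by simp
    define q where "q = take (Suc k) p"
    have q: "induced_path q" "hd q = x" "last q = p ! k" "set q = {p ! i | i. i \<le> k}"
      using induced_path_slice[OF p(1), of 0 k] kl p(2) ne by (auto simp: q_def hd_conv_nth)
    have qX: "set q \<subseteq> X" using p(4) set_take_subset unfolding q_def by fast
    show ?case
    proof (cases "p ! k = z")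
      case True
      then show ?thesis using q qX by blast
    next
      case False
      have "\<not> v \<rightarrow> z" if v: "v \<in> set (butlast q)" for v
      proof -
        have "butlast q = take k p" using kl by (simp add: q_def butlast_take)
        then obtain i where "i < k" "v = p ! i"
          using v kl by (auto simp: in_set_conv_nth)
        then show ?thesis using least[of i] kl by auto
      qed
      moreover have "z \<notin> set q"
      proof
        assume "z \<in> set q"
        then obtain i where "i \<le> k" "p ! i = z" using q(4) by auto
        then show False using False least[of i] kl by (cases "i = k") auto
      qed
      moreover have "last q \<rightarrow> z" using k False q(3) by simp
      ultimately have "induced_path (q @ [z])" using q(1) induced_path_snoc by blast
      moreover have "q \<noteq> []" using q(1) by (simp add: induced_path_def)
      ultimately show ?thesis using q qX yz by (intro exI[of _ "q @ [z]"]) auto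
    qed
  qed
  with that show ?thesis by blast
qed

lemma induced_path3:
  assumes "x \<rightarrow> y" "y \<rightarrow> z" "\<not> x \<rightarrow> z" "x \<noteq> z"
  shows "induced_path [x, y, z]"
proof -
  have "induced_path ([x] @ [y])"
    using assms adj_in_verts adj_not_same
    by (intro induced_path_snoc induced_path_singleton) auto
  then have "induced_path (([x] @ [y]) @ [z])"
    by (rule induced_path_snoc) (use assms adj_not_same in auto)
  then show ?thesis by simp
qed

lemma induced_path4:
  assumes "x \<rightarrow> y" "y \<rightarrow> z" "z \<rightarrow> t" "\<not> x \<rightarrow> z" "\<not> x \<rightarrow> t" "\<not> y \<rightarrow> t" "x \<noteq> z" "x \<noteq> t" "y \<noteq> t"
  shows "induced_path [x, y, z, t]"
proof -
  have "induced_path [x, y, z]" using assms by (intro induced_path3)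
  then have "induced_path ([x, y, z] @ [t])"
    by (rule induced_path_snoc) (use assms adj_not_same in auto)
  then show ?thesis by simp
qed

text \<open>It suffices to consider the chordless paths whose inner vertices all lie outside \<open>C\<close>; only the
  first and the last of them, \<open>v\<close> and \<open>w\<close>, are recorded.\<close>

lemma mono_convexI:
  assumes "C \<subseteq> verts G"
    and "\<And>p x y v w. \<lbrakk>induced_path p; hd p = x; last p = y; x \<in> C; y \<in> C; x \<noteq> y; \<not> x \<rightarrow> y;
          v \<in> set p - C; w \<in> set p - C; x \<rightarrow> v; w \<rightarrow> y\<rbrakk> \<Longrightarrow> False"
  shows "mono_convex G C"
  unfolding mono_convex_def
proof (intro conjI ballI allI impI subsetI assms(1)[THEN subsetD])
  fix u v p z
  assume uv: "u \<in> C" "v \<in> C" and "chordless_path G u p v" and z: "z \<in> set p"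
  then have p: "induced_path p" "hd p = u" "last p = v" by (auto simp: chordless_path_iff)
  then have ne: "p \<noteq> []" and dist: "distinct p"
    and adj: "\<And>i j. i < j \<Longrightarrow> j < length p \<Longrightarrow> p ! i \<rightarrow> p ! j \<longleftrightarrow> j = Suc i"
    by (auto simp: induced_path_def)
  show "z \<in> C"
  proof (rule ccontr)
    assume "z \<notin> C"
    obtain k where k: "k < length p" "p ! k = z" using z by (metis in_set_conv_nth)
    \<comment> \<open>\<open>Greatest P\<close> and \<open>Least Q\<close> are the positions in
      \<open>C\<close> closest to that of \<open>z\<close> on either side; the segment between them
      has all its inner vertices outside \<open>C\<close>.\<close>
    define P where "P i \<longleftrightarrow> i \<le> k \<and> p ! i \<in> C" for i
    define Q where "Q i \<longleftrightarrow> k \<le> i \<and> i < length p \<and> p ! i \<in> C" for i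
    have "P 0" using p uv ne by (simp add: P_def hd_conv_nth)
    moreover have bound: "P i \<Longrightarrow> i \<le> k" for i by (simp add: P_def)
    ultimately have i: "P (Greatest P)" and iG: "\<And>j. P j \<Longrightarrow> j \<le> Greatest P"
      by (auto intro: GreatestI_nat[where b = k] Greatest_le_nat[where b = k])
    have "Q (length p - 1)" using p uv ne k by (auto simp: Q_def last_conv_nth)
    then have j: "Q (Least Q)" and jL: "\<And>i. Q i \<Longrightarrow> Least Q \<le> i"
      by (auto intro: LeastI Least_le)
    define i where "i = Greatest P"
    define j where "j = Least Q"
    have ij: "i < k" "k < j" "j < length p" "p ! i \<in> C" "p ! j \<in> C"
      using i j \<open>z \<notin> C\<close> k unfolding P_def Q_def i_def j_def by (auto simp: le_less)
    have between: "p ! l \<notin> C" if "i < l" "l < j" for l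
    proof (cases "l \<le> k")
      case True
      then show ?thesis using iG[of l] that by (auto simp: P_def i_def)
    next
      case False
      then show ?thesis using jL[of l] that ij by (auto simp: Q_def j_def)
    qed
    define q where "q = drop i (take (Suc j) p)"
    have q: "induced_path q" "hd q = p ! i" "last q = p ! j" "set q = {p ! l | l. i \<le> l \<and> l \<le> j}"
      using induced_path_slice[OF p(1), of i j] ij by (auto simp: q_def)
    show False
    proof (rule assms(2)[OF q(1-3) ij(4,5)])
      show "p ! i \<noteq> p ! j" using ij dist by (simp add: nth_eq_iff_index_eq)
      show "\<not> p ! i \<rightarrow> p ! j" using adj[of i j] ij by simp
      show "p ! Suc i \<in> set q - C" using between[of "Suc i"] ij unfolding q(4) by auto
      have "p ! (j - 1) \<notin> C" using between[of "j - 1"] ij by auto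
      moreover have "i \<le> j - 1" "j - 1 \<le> j" using ij by auto
      ultimately show "p ! (j - 1) \<in> set q - C" unfolding q(4) by auto
      show "p ! i \<rightarrow> p ! Suc i" using adj[of i "Suc i"] ij by simp
      show "p ! (j - 1) \<rightarrow> p ! j" using adj[of "j - 1" j] ij by simp
    qed
  qed
qed

section \<open>Connectedness of convex sets\<close>

lemma walk_of_induced_path:
  assumes "induced_path p"
  shows "(hd p, last p) \<in> (Restr (arcs_ends G) (set p))\<^sup>*"
proof -
  have p: "p \<noteq> []" and adj: "\<And>i. Suc i < length p \<Longrightarrow> p ! i \<rightarrow> p ! Suc i"
    using assms by (auto simp: induced_path_def)
  have "(p ! 0, p ! i) \<in> (Restr (arcs_ends G) (set p))\<^sup>*" if "i < length p" for i
    using that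
  proof (induction i)
    case (Suc i)
    then have "(p ! i, p ! Suc i) \<in> Restr (arcs_ends G) (set p)" using adj by auto
    with Suc show ?case by (auto intro: rtrancl_into_rtrancl)
  qed simp
  with p show ?thesis by (simp add: hd_conv_nth last_conv_nth)
qed

lemma connected_walk:
  assumes "connected G" "x \<in> verts G" "y \<in> verts G"
  shows "(x, y) \<in> (arcs_ends G)\<^sup>*"
  using symmetric_connected_imp_strongly_connected[OF sym_arcs assms(1)] assms(2,3)
  by (auto simp: strongly_connected_def reachable_conv)

text \<open>Connectedness of the graph supplies a walk; a chordless path extracted from it stays in
  \<open>C\<close> by convexity.\<close>

lemma mono_convex_walk:
  assumes "connected G" "mono_convex G C" "x \<in> C" "y \<in> C"
  shows "(x, y) \<in> (Restr (arcs_ends G) C)\<^sup>*"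
proof -
  have V: "x \<in> verts G" "y \<in> verts G" using assms by (auto simp: mono_convex_def)
  have "Restr (arcs_ends G) (verts G) = arcs_ends G" using adj_in_verts by auto
  then have "(x, y) \<in> (Restr (arcs_ends G) (verts G))\<^sup>*"
    using connected_walk[OF assms(1) V] by simp
  then obtain p where p: "induced_path p" "hd p = x" "last p = y"
    using induced_path_of_walk V by metis
  then have "set p \<subseteq> C" using mono_convexD assms by blast
  then have "Restr (arcs_ends G) (set p) \<subseteq> Restr (arcs_ends G) C" by blast
  then show ?thesis using walk_of_induced_path[OF p(1)] p rtrancl_mono by blast
qed

text \<open>A distinct list with equal ends has length one. This later gives the minimality of
  two-element forbidden sets.\<close>

lemma mono_convex_singleton:
  assumes "v \<in> verts G"
  shows "mono_convex G {v}"
proof -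
  have "set p \<subseteq> {v}" if p: "induced_path p" "hd p = v" "last p = v" for p
  proof -
    have "p \<noteq> []" "distinct p" using p by (auto simp: induced_path_def)
    then show ?thesis using p by (cases p) (auto split: if_splits)
  qed
  with assms show ?thesis by (auto simp: mono_convex_def chordless_path_iff)
qed

section \<open>The rim\<close>

text \<open>The formula favours \<open>A\<close>; for a saturated pair \<open>rim_commute\<close>
  restores the symmetry.\<close>

definition rim :: "'a set \<Rightarrow> 'a set \<Rightarrow> 'a set" where
  "rim A B = {v \<in> verts G - (A \<union> B). \<exists>x\<in>A. x \<rightarrow> v}"

lemma rimI: "x \<in> A \<Longrightarrow> x \<rightarrow> v \<Longrightarrow> v \<notin> A \<Longrightarrow> v \<notin> B \<Longrightarrow> v \<in> rim A B"
  using adj_in_verts by (auto simp: rim_def)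

lemma rimD: "v \<in> rim A B \<Longrightarrow> v \<in> verts G \<and> v \<notin> A \<and> v \<notin> B"
  by (auto simp: rim_def)

end

lemma far_components_commute: "far_components G A B = far_components G B A"
  by (simp add: far_components_def Un_commute)

text \<open>The pre-saturation is the term of index 1 of the sequence, hence part of its union;
  conversely, a vertex of \<open>A\<close> belongs to the shadow because it lies in the hull of
  \<open>B\<close> with itself. Saturation enters the rest of the proof only through this
  equation.\<close>

lemma saturated_presaturation:
  assumes "saturated G A B" "A \<subseteq> verts G"
  shows "presaturation G A B = A"
proof
  have "fst (saturation_seq G A B 1) \<subseteq> saturation G A B"
    unfolding saturation_def by blast
  then show "presaturation G A B \<subseteq> A"
    using assms(1) by (simp add: saturated_def)
  have "A \<subseteq> shadow G A B"
    using assms(2) hull_subset unfolding shadow_def cl_def by fastforce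
  then show "A \<subseteq> presaturation G A B"
    using hull_subset[of _ "mono_convex G"] unfolding presaturation_def cl_def by blast
qed


subsection \<open>Saturated pairs\<close>

locale saturated_pair = undirected_graph +
  fixes A B :: "'a set"
  assumes connected: "connected G"
    and A_verts: "A \<subseteq> verts G" and B_verts: "B \<subseteq> verts G"
    and disjoint: "A \<inter> B = {}" and linked: "linked G A B"
    and presaturation_A: "presaturation G A B = A"
    and presaturation_B: "presaturation G B A = B"
begin

text \<open>The locale assumptions are symmetric in the two sets, so facts proved for
  \<open>A\<close> transfer to \<open>B\<close>.\<close>

lemma swap: "saturated_pair G B A"
proof unfold_locales
  show "linked G B A" using linked adj_sym by (auto simp: linked_def)
qed (use connected A_verts B_verts disjoint presaturation_A presaturation_B in auto)

lemma mono_convex_A: "mono_convex G A"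
proof -
  obtain Z where "A = cl G Z" using presaturation_A by (auto simp: presaturation_def)
  then show ?thesis using A_verts cl_path by (auto simp: mono_convex_def chordless_path_iff)
qed

lemma shadow_A: "v \<in> verts G \<Longrightarrow> cl G (B \<union> {v}) \<inter> A \<noteq> {} \<Longrightarrow> v \<in> A"
proof -
  assume "v \<in> verts G" "cl G (B \<union> {v}) \<inter> A \<noteq> {}"
  then have "v \<in> presaturation G A B"
    unfolding presaturation_def by (intro cl_subset[THEN subsetD]) (simp add: shadow_def)
  then show "v \<in> A" by (simp only: presaturation_A)
qed

text \<open>This is the part of the pre-saturation that comes from minimal forbidden sets; it is
  applied to a pair of nonadjacent rim vertices.\<close>

lemma mfs_Inter_A: "X \<in> mfs G A B \<Longrightarrow> \<forall>x\<in>X. w \<in> cl G (A \<union> {x}) \<Longrightarrow> w \<in> A"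
proof -
  assume "X \<in> mfs G A B" "\<forall>x\<in>X. w \<in> cl G (A \<union> {x})"
  then have "w \<in> presaturation G A B"
    unfolding presaturation_def by (intro cl_subset[THEN subsetD]) blast
  then show "w \<in> A" by (simp only: presaturation_A)
qed

text \<open>If the hull met \<open>A\<close>, then \<open>v\<close> would lie in the shadow of
  \<open>A\<close> with respect to \<open>B\<close>, hence in \<open>A\<close>.\<close>

lemma cl_disjoint_A:
  assumes "v \<in> rim A B"
  shows "cl G (B \<union> {v}) \<inter> A = {}"
  using shadow_A[of v] rimD[OF assms] by argo

text \<open>As \<open>A\<close> is connected, \<open>v\<close> reaches \<open>b\<close> through
  \<open>A\<close>. If \<open>v\<close> did not see \<open>b\<close>, the second vertex of a
  chordless path from \<open>v\<close> to \<open>b\<close> through \<open>A\<close> would lie both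
  in \<open>A\<close> and in the hull of \<open>B\<close> with \<open>v\<close>.\<close>

lemma rim_adj_B:
  assumes v: "v \<in> rim A B" and ab: "a \<in> A" "b \<in> B" "a \<rightarrow> b"
  shows "v \<rightarrow> b"
proof (rule ccontr)
  assume nvb: "\<not> v \<rightarrow> b"
  obtain x where x: "x \<in> A" "v \<rightarrow> x" using v adj_sym by (auto simp: rim_def)
  let ?X = "A \<union> {v, b}"
  have "(x, a) \<in> (Restr (arcs_ends G) ?X)\<^sup>*"
    using mono_convex_walk[OF connected mono_convex_A x(1) ab(1)]
      rtrancl_mono[of "Restr (arcs_ends G) A" "Restr (arcs_ends G) ?X"] by blast
  moreover have "(v, x) \<in> Restr (arcs_ends G) ?X" "(a, b) \<in> Restr (arcs_ends G) ?X"
    using x ab by auto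
  ultimately have "(v, b) \<in> (Restr (arcs_ends G) ?X)\<^sup>*"
    by (meson converse_rtrancl_into_rtrancl rtrancl_into_rtrancl)
  then obtain p where p: "induced_path p" "hd p = v" "last p = b" "set p \<subseteq> ?X"
    using induced_path_of_walk[of v b ?X] v rimD by blast
  have "v \<noteq> b" using v ab rimD by blast
  then obtain w q where q: "p = v # w # q"
    using p by (cases p; cases "tl p") (auto simp: induced_path_def)
  have "v \<rightarrow> w" "w \<noteq> v"
    using p(1) unfolding q induced_path_def by force+
  then have "w \<in> A" using p(4) q nvb by auto
  moreover have "set p \<subseteq> cl G (B \<union> {v})"
    using cl_path[OF p(1)] p(2,3) cl_subset[of "B \<union> {v}"] ab by auto
  ultimately show False using cl_disjoint_A[OF v] q by auto
qed

lemma rim_subset_swap: "rim A B \<subseteq> rim B A"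
proof
  fix v assume v: "v \<in> rim A B"
  obtain a b where "a \<in> A" "b \<in> B" "a \<rightarrow> b" using linked by (auto simp: linked_def)
  then show "v \<in> rim B A" using rimI[of b B v A] rim_adj_B[OF v] v rimD adj_sym by blast
qed

lemma rim_commute: "rim B A = rim A B"
  using rim_subset_swap saturated_pair.rim_subset_swap[OF swap] by (rule subset_antisym[rotated])

lemma rim_adj:
  assumes "v \<in> rim A B" "a \<in> A" "b \<in> B" "a \<rightarrow> b"
  shows "v \<rightarrow> a" "v \<rightarrow> b"
proof -
  have "v \<in> rim B A" using assms(1) rim_commute by simp
  then show "v \<rightarrow> a"
    using saturated_pair.rim_adj_B[OF swap] assms(2,3) adj_sym[OF assms(4)] by metis
  show "v \<rightarrow> b" using rim_adj_B[OF assms] .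
qed

section \<open>Nonadjacent rim vertices\<close>

text \<open>The ends of a linking edge are common neighbours of \<open>m\<close> and
  \<open>m'\<close>, so the hull meets both sides; a proper subset lies in a singleton, which is
  convex.\<close>

lemma nonadjacent_rim_mfs:
  assumes m: "m \<in> rim A B" "m' \<in> rim A B" "m \<noteq> m'" "\<not> m \<rightarrow> m'"
  shows "{m, m'} \<in> mfs G A B"
proof -
  obtain a b where ab: "a \<in> A" "b \<in> B" "a \<rightarrow> b" using linked by (auto simp: linked_def)
  have meets: "z \<in> cl G {m, m'}" if "m \<rightarrow> z" "m' \<rightarrow> z" for z
    using cl_path[OF induced_path3[of m z m']] that m adj_sym cl_subset[of "{m, m'}"] by auto
  have "\<not> forbidden G A B Y" if Y: "Y \<subset> {m, m'}" for Y
  proof -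
    obtain z where z: "Y \<subseteq> {z}" "z \<in> rim A B" using Y m by blast
    then have "cl G Y \<subseteq> {z}" using cl_minimal mono_convex_singleton rimD by blast
    then show ?thesis using rimD[OF z(2)] by (auto simp: forbidden_def)
  qed
  moreover have "forbidden G A B {m, m'}"
    using meets rim_adj[OF m(1) ab] rim_adj[OF m(2) ab] ab rimD[OF m(1)] rimD[OF m(2)]
    by (auto simp: forbidden_def)
  ultimately show ?thesis unfolding mfs_def by blast
qed

text \<open>If \<open>x\<close> were not adjacent to \<open>m\<close>, the path \<open>x, m', b, m\<close> would be chordless for a vertex
  \<open>b\<close> of \<open>B\<close> with a neighbour in \<open>A\<close>, so that \<open>m\<close> would lie in the shadow of \<open>B\<close>.\<close>

lemma nonadjacent_rim_adj_A:
  assumes m: "m \<in> rim A B" "m' \<in> rim A B" "m \<noteq> m'" "\<not> m \<rightarrow> m'"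
    and x: "x \<in> A" "x \<rightarrow> m'"
  shows "x \<rightarrow> m"
proof (rule ccontr)
  assume nxm: "\<not> x \<rightarrow> m"
  obtain a b where ab: "a \<in> A" "b \<in> B" "a \<rightarrow> b" using linked by (auto simp: linked_def)
  have "\<not> x \<rightarrow> b" using rim_adj(1)[OF m(1) x(1) ab(2)] nxm adj_sym by blast
  then have "induced_path [x, m', b, m]"
    using rim_adj m ab nxm x adj_sym disjoint rimD
    by (intro induced_path4) blast+
  from cl_path[OF this] have "b \<in> cl G (A \<union> {m})"
    using cl_subset[of "A \<union> {m}"] x by auto
  then show False
    using saturated_pair.cl_disjoint_A[OF swap, of m] m rim_commute ab by blast
qed

text \<open>If \<open>x\<close> were adjacent to \<open>w\<close> only, then \<open>w\<close> would lie in the hulls of \<open>A\<close> with \<open>m\<close> and with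
  \<open>m'\<close>, against saturation; if it were adjacent to \<open>m\<close> and \<open>m'\<close> only, then the hull of \<open>A\<close> with
  \<open>w\<close> would contain both and so meet \<open>B\<close>.\<close>

lemma nonadjacent_rim_adj_A_iff:
  assumes m: "m \<in> rim A B" "m' \<in> rim A B" "m \<noteq> m'" "\<not> m \<rightarrow> m'" and w: "w \<in> rim A B"
    and x: "x \<in> A"
  shows "x \<rightarrow> w \<longleftrightarrow> x \<rightarrow> m"
proof -
  obtain a b where ab: "a \<in> A" "b \<in> B" "a \<rightarrow> b" using linked by (auto simp: linked_def)
  have m': "x \<rightarrow> m' \<longleftrightarrow> x \<rightarrow> m"
    using nonadjacent_rim_adj_A m x adj_sym by blast
  have between: "z \<in> cl G (A \<union> {t})" if "x \<rightarrow> z" "z \<rightarrow> t" "\<not> x \<rightarrow> t" "t \<in> rim A B" for z t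
    using cl_path[OF induced_path3[of x z t]] that x cl_subset[of "A \<union> {t}"] rimD[OF that(4)]
    by auto
  \<comment> \<open>The first two cases compare \<open>w\<close> with \<open>m\<close> or
    \<open>m'\<close> by \<open>nonadjacent_rim_adj_A\<close>; what is left is a common neighbour of
    both.\<close>
  consider "w = m \<or> \<not> w \<rightarrow> m" | "w = m' \<or> \<not> w \<rightarrow> m'" | "w \<rightarrow> m" "w \<rightarrow> m'" by blast
  then show ?thesis
  proof cases
    case 1
    then show ?thesis using nonadjacent_rim_adj_A m w x adj_sym by blast
  next
    case 2
    then show ?thesis using nonadjacent_rim_adj_A m w x adj_sym m' by blast
  next
    case 3
    show ?thesis
    proof (rule ccontr)
      assume "\<not> ?thesis"
      then consider "x \<rightarrow> w" "\<not> x \<rightarrow> m" "\<not> x \<rightarrow> m'" | "\<not> x \<rightarrow> w" "x \<rightarrow> m" "x \<rightarrow> m'"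
        using m' by blast
      then show False
      proof cases
        case 1
        then have "w \<in> cl G (A \<union> {m})" "w \<in> cl G (A \<union> {m'})"
          using between 3 m by blast+
        then show False using mfs_Inter_A[OF nonadjacent_rim_mfs[OF m]] w rimD by blast
      next
        case 2
        then have "m \<in> cl G (A \<union> {w})" "m' \<in> cl G (A \<union> {w})"
          using between 3 w adj_sym by blast+
        moreover have "induced_path [m, b, m']"
          using rim_adj m ab adj_sym by (intro induced_path3) blast+
        ultimately have "b \<in> cl G (A \<union> {w})"
          using cl_path[of "[m, b, m']"] by auto
        then show False
          using saturated_pair.cl_disjoint_A[OF swap, of w] w rim_commute ab by blast
      qed
    qed
  qed
qed

section \<open>Convexity of one side of a colouring\<close>

text \<open>Where a chordless path leaves the set, an end outside \<open>A\<close> is in the rim.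
  Two such ends are adjacent by \<open>clique\<close>. If only one end is in \<open>A\<close>, its
  neighbour on the path is a rim vertex of the other colour, and \<open>nbhd\<close> makes the two
  ends adjacent.\<close>

lemma mono_convex_side:
  assumes far: "\<And>s t. \<lbrakk>s \<in> verts G - (A \<union> B); s \<notin> rim A B; t \<in> verts G - (A \<union> B); s \<rightarrow> t\<rbrakk>
      \<Longrightarrow> P s \<longleftrightarrow> P t"
    and clique: "\<And>m m'. \<lbrakk>m \<in> rim A B; m' \<in> rim A B; P m; P m'; m \<noteq> m'\<rbrakk> \<Longrightarrow> m \<rightarrow> m'"
    and nbhd: "\<And>x v w. \<lbrakk>w \<in> rim A B; \<not> P w; v \<in> rim A B; P v; x \<in> A; x \<rightarrow> w\<rbrakk> \<Longrightarrow> x \<rightarrow> v"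
  shows "mono_convex G (A \<union> {v \<in> verts G - (A \<union> B). P v})" (is "mono_convex G ?C")
proof (rule mono_convexI)
  show "?C \<subseteq> verts G" using A_verts by auto
next
  fix p x y v w
  assume p: "induced_path p" "hd p = x" "last p = y" and xy: "x \<in> ?C" "y \<in> ?C" "x \<noteq> y" "\<not> x \<rightarrow> y"
    and v: "v \<in> set p - ?C" "x \<rightarrow> v" and w: "w \<in> set p - ?C" "w \<rightarrow> y"
  \<comment> \<open>Off the rim, an outside vertex has no neighbour in \<open>B\<close>, and its
    outside neighbours share its colour by \<open>far\<close>.\<close>
  have rim: "z \<in> rim A B" if "z \<in> ?C" "z \<notin> A" "z' \<in> set p - ?C" "z \<rightarrow> z'" for z z'
  proof (rule ccontr)
    assume nz: "z \<notin> rim A B"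
    have "z' \<notin> B"
      using that nz rim_commute rimI[of z' B z A] adj_sym by blast
    moreover have "z' \<in> verts G" using that adj_in_verts by blast
    ultimately show False using far[of z z'] that nz by blast
  qed
  \<comment> \<open>The hull of \<open>A\<close> with a rim vertex misses \<open>B\<close>, so a
    path vertex not in the set has the other colour.\<close>
  have rest: "z \<in> verts G - (A \<union> B) \<and> \<not> P z"
    if "z \<in> set p - ?C" "t \<in> rim A B" "set p \<subseteq> cl G (A \<union> {t})" for z t
  proof -
    have "z \<in> verts G" using p that by (auto simp: induced_path_def)
    moreover have "z \<notin> B"
      using that saturated_pair.cl_disjoint_A[OF swap, of t] rim_commute by blast
    ultimately show ?thesis using that by blast
  qed
  show False
  proof (cases "x \<in> A"; cases "y \<in> A")
    assume "x \<in> A" "y \<in> A"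
    then have "set p \<subseteq> A" using mono_convexD[OF mono_convex_A] p by blast
    then show False using v by blast
  next
    assume "x \<notin> A" "y \<notin> A"
    then show False using rim clique xy v w adj_sym by blast
  next
    assume x: "x \<in> A" and y: "y \<notin> A"
    have "set p \<subseteq> cl G (A \<union> {y})"
      using cl_path[OF p(1)] p(2,3) x cl_subset[of "A \<union> {y}"] by auto
    moreover have ry: "y \<in> rim A B" using rim xy y w adj_sym by blast
    ultimately have "v \<in> verts G - (A \<union> B)" "\<not> P v" using rest v by blast+
    then have "x \<rightarrow> y" using nbhd[of v y x] rimI[of x A v B] x v ry xy y by blast
    then show False using xy by blast
  next
    assume x: "x \<notin> A" and y: "y \<in> A"
    have "set p \<subseteq> cl G (A \<union> {x})"
      using cl_path[OF p(1)] p(2,3) y cl_subset[of "A \<union> {x}"] by auto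
    moreover have rx: "x \<in> rim A B" using rim xy x v by blast
    ultimately have "w \<in> verts G - (A \<union> B)" "\<not> P w" using rest w by blast+
    then have "y \<rightarrow> x" using nbhd[of w x y] rimI[of y A w B] y w rx xy x adj_sym by blast
    then show False using xy adj_sym by blast
  qed
qed

subsection \<open>The equivalence relation\<close>

lemma far_verts: "verts G - closed_nbhd G (A \<union> B) = verts G - (A \<union> B) - rim A B"
proof -
  have "nbhd G (A \<union> B) = rim A B \<union> rim B A"
    using adj_sym by (fastforce simp: nbhd_def rim_def)
  then show ?thesis by (auto simp: closed_nbhd_def rim_commute)
qed

text \<open>Adjacency is symmetric, so the mutual reachability that defines strong components
  reduces to reachability from one root \<open>s\<close>.\<close>

lemma far_components_iff:
  "S \<in> far_components G A B \<longleftrightarrow>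
     (\<exists>s \<in> verts G - (A \<union> B) - rim A B.
        S = {t. (s, t) \<in> (Restr (arcs_ends G) (verts G - (A \<union> B) - rim A B))\<^sup>*})"
proof -
  let ?F = "verts G - (A \<union> B) - rim A B"
  let ?R = "Restr (arcs_ends G) ?F"
  interpret H: wf_digraph "G \<restriction> ?F" by blast
  have ends: "arcs_ends (G \<restriction> ?F) = ?R" by (auto simp: arcs_ends_induce)
  \<comment> \<open>\<open>rtrancl\<close> is reflexive at every point, so membership of
    \<open>u\<close> in the subgraph is required separately.\<close>
  have reach: "u \<rightarrow>\<^sup>*\<^bsub>G \<restriction> ?F\<^esub> v \<longleftrightarrow> u \<in> ?F \<and> (u, v) \<in> ?R\<^sup>*" for u v
  proof -
    have "v \<in> ?F" if "(u, v) \<in> ?R\<^sup>*" "u \<in> ?F"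
      using that by (induction rule: rtrancl_induct) auto
    then show ?thesis unfolding H.reachable_conv ends by auto
  qed
  have "sym ?R" using adj_sym by (auto intro!: symI)
  then have sym: "(u, v) \<in> ?R\<^sup>* \<Longrightarrow> (v, u) \<in> ?R\<^sup>*" for u v
    by (meson sym_rtrancl symD)
  have "S \<in> H.sccs_verts \<longleftrightarrow> (\<exists>s\<in>?F. S = {t. (s, t) \<in> ?R\<^sup>*})" (is "?scc \<longleftrightarrow> ?class")
  proof
    assume ?scc
    then obtain s where s: "s \<in> S"
      and S: "\<And>u v. u \<in> S \<Longrightarrow> v \<in> S \<Longrightarrow> u \<rightarrow>\<^sup>*\<^bsub>G \<restriction> ?F\<^esub> v"
        "\<And>u v. u \<in> S \<Longrightarrow> v \<notin> S \<Longrightarrow> \<not> u \<rightarrow>\<^sup>*\<^bsub>G \<restriction> ?F\<^esub> v \<or> \<not> v \<rightarrow>\<^sup>*\<^bsub>G \<restriction> ?F\<^esub> u"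
      unfolding H.sccs_verts_def by blast
    have sF: "s \<in> ?F" using S(1)[OF s s] reach by blast
    have "v \<in> S" if "(s, v) \<in> ?R\<^sup>*" for v
    proof -
      have sv: "s \<rightarrow>\<^sup>*\<^bsub>G \<restriction> ?F\<^esub> v" using that sF reach by blast
      then have "v \<in> ?F" using H.reachable_in_verts(2) by fastforce
      then have "v \<rightarrow>\<^sup>*\<^bsub>G \<restriction> ?F\<^esub> s" using sym[OF that] reach by blast
      with sv show ?thesis using S(2)[OF s] by blast
    qed
    then have "S = {t. (s, t) \<in> ?R\<^sup>*}" using S(1)[OF s] reach by blast
    then show ?class using sF by blast
  next
    assume ?class
    then obtain s where s: "s \<in> ?F" "S = {t. (s, t) \<in> ?R\<^sup>*}" by blast
    have SF: "S \<subseteq> ?F"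
    proof
      fix t assume "t \<in> S"
      then have "s \<rightarrow>\<^sup>*\<^bsub>G \<restriction> ?F\<^esub> t" using s reach by blast
      then show "t \<in> ?F" using H.reachable_in_verts(2) by fastforce
    qed
    have "u \<rightarrow>\<^sup>*\<^bsub>G \<restriction> ?F\<^esub> v" if "u \<in> S" "v \<in> S" for u v
    proof -
      have "(u, s) \<in> ?R\<^sup>*" "(s, v) \<in> ?R\<^sup>*" using that sym s by simp_all
      then have "(u, v) \<in> ?R\<^sup>*" by (rule rtrancl_trans)
      then show ?thesis using that SF reach by blast
    qed
    moreover have "\<not> u \<rightarrow>\<^sup>*\<^bsub>G \<restriction> ?F\<^esub> v" if "u \<in> S" "v \<notin> S" for u v
    proof
      assume "u \<rightarrow>\<^sup>*\<^bsub>G \<restriction> ?F\<^esub> v"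
      then have "(u, v) \<in> ?R\<^sup>*" using reach by simp
      moreover have "(s, u) \<in> ?R\<^sup>*" using that s by simp
      ultimately have "(s, v) \<in> ?R\<^sup>*" by (rule rtrancl_trans[rotated])
      then show False using that s by simp
    qed
    ultimately show ?scc unfolding H.sccs_verts_def using s by blast
  qed
  then show ?thesis by (simp add: far_components_def far_verts)
qed

lemma far_componentD:
  assumes "S \<in> far_components G A B"
  shows "S \<noteq> {}" and "S \<subseteq> verts G - (A \<union> B) - rim A B"
    and "\<And>s t. \<lbrakk>s \<in> S; t \<in> verts G - (A \<union> B) - rim A B; s \<rightarrow> t\<rbrakk> \<Longrightarrow> t \<in> S"
    and "\<And>s t. \<lbrakk>s \<in> S; t \<in> S\<rbrakk> \<Longrightarrow> (s, t) \<in> (Restr (arcs_ends G) S)\<^sup>*"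
proof -
  let ?F = "verts G - (A \<union> B) - rim A B"
  let ?R = "Restr (arcs_ends G) ?F"
  obtain r where r: "r \<in> ?F" and S: "S = {t. (r, t) \<in> ?R\<^sup>*}"
    using assms far_components_iff by blast
  show "S \<noteq> {}" using S by blast
  show SF: "S \<subseteq> ?F"
  proof
    fix t assume "t \<in> S"
    then have "(r, t) \<in> ?R\<^sup>*" using S by blast
    then show "t \<in> ?F" using r by (induction rule: rtrancl_induct) auto
  qed
  show "t \<in> S" if "s \<in> S" "t \<in> ?F" "s \<rightarrow> t" for s t
  proof -
    have "(r, s) \<in> ?R\<^sup>*" "(s, t) \<in> ?R" using that S SF by blast+
    then show ?thesis unfolding S by (simp add: rtrancl_into_rtrancl)
  qed
  \<comment> \<open>A walk from the root visits only vertices reachable from it, hence stays in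
    \<open>S\<close> itself.\<close>
  have to_S: "(r, t) \<in> (Restr (arcs_ends G) S)\<^sup>*" if "t \<in> S" for t
  proof -
    have "(r, t) \<in> ?R\<^sup>*" using that S by blast
    then show ?thesis
    proof (induction rule: rtrancl_induct)
      case (step y z)
      then have "(y, z) \<in> Restr (arcs_ends G) S"
        unfolding S by (auto intro: rtrancl_into_rtrancl)
      with step.IH show ?case by (rule rtrancl_into_rtrancl)
    qed simp
  qed
  have "sym (Restr (arcs_ends G) S)" using adj_sym by (auto intro!: symI)
  then have "sym ((Restr (arcs_ends G) S)\<^sup>*)" by (rule sym_rtrancl)
  then show "(s, t) \<in> (Restr (arcs_ends G) S)\<^sup>*" if "s \<in> S" "t \<in> S" for s t
    using to_S[OF that(1)] to_S[OF that(2)] by (meson rtrancl_trans symD)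
qed

lemma far_component_exists:
  assumes "s \<in> verts G - (A \<union> B)" "s \<notin> rim A B"
  obtains S where "S \<in> far_components G A B" "s \<in> S"
  using assms far_components_iff by blast

text \<open>A neighbour in \<open>A\<close> or \<open>B\<close> would put a vertex of
  \<open>S\<close> into the rim, and an outside neighbour off the rim would belong to
  \<open>S\<close>.\<close>

lemma far_component_nbhd:
  assumes "S \<in> far_components G A B"
  shows "nbhd G S \<subseteq> rim A B"
proof
  fix m assume "m \<in> nbhd G S"
  then obtain s where s: "s \<in> S" "m \<rightarrow> s" "m \<in> verts G" "m \<notin> S" by (auto simp: nbhd_def)
  have "s \<notin> A" "s \<notin> B" "s \<notin> rim A B" using far_componentD(2)[OF assms] s by blast+
  then have "m \<notin> A" "m \<notin> B"
    using rimI[of m A s B] rimI[of m B s A] s rim_commute by blast+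
  then show "m \<in> rim A B" using far_componentD(3)[OF assms s(1)] s adj_sym by blast
qed

text \<open>Otherwise \<open>S\<close> would be closed under adjacency and, the graph being
  connected, contain a vertex of \<open>A\<close>.\<close>

lemma far_component_nbhd_nonempty:
  assumes "S \<in> far_components G A B"
  shows "nbhd G S \<noteq> {}"
proof
  assume empty: "nbhd G S = {}"
  obtain s where s: "s \<in> S" using far_componentD(1)[OF assms] by blast
  obtain a where a: "a \<in> A" using linked by (auto simp: linked_def)
  have "(s, a) \<in> (arcs_ends G)\<^sup>*"
    using connected_walk[OF connected] far_componentD(2)[OF assms] s a A_verts by blast
  then have "a \<in> S"
  proof (induction rule: rtrancl_induct)
    case (step y z)
    then have "z \<in> verts G" "z \<rightarrow> y" using adj_sym adj_in_verts by blast+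
    then show ?case using empty step.IH unfolding nbhd_def by blast
  qed (rule s)
  then show False using a far_componentD(2)[OF assms] by blast
qed

lemma far_component_unique:
  assumes "S \<in> far_components G A B" "T \<in> far_components G A B" "v \<in> S" "v \<in> T"
  shows "S = T"
  using wf_digraph.sccs_verts_disjoint[OF wellformed_induce_subgraph] assms
  unfolding far_components_def by blast

section \<open>Chains of overlapping components\<close>

text \<open>A nonempty intersecting sequence is a walk in this relation, so its reflexive transitive
  closure can replace lists of components.\<close>

definition overlap :: "'a set rel" where
  "overlap = {(S, T). S \<in> far_components G A B \<and> T \<in> far_components G A B \<and>
     nbhd G S \<inter> nbhd G T \<noteq> {}}"

lemma sym_overlap_rtrancl: "(S, T) \<in> overlap\<^sup>* \<Longrightarrow> (T, S) \<in> overlap\<^sup>*"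
proof -
  have "sym overlap" by (auto simp: overlap_def sym_def)
  then show "(S, T) \<in> overlap\<^sup>* \<Longrightarrow> (T, S) \<in> overlap\<^sup>*" by (meson sym_rtrancl symD)
qed

text \<open>\<open>S\<close> and \<open>T\<close> may occur in either order; both are joined to the
  first entry, and chains can be reversed.\<close>

lemma intersecting_seq_overlap:
  assumes "intersecting_seq G A B Ss" "S \<in> set Ss" "T \<in> set Ss"
  shows "(S, T) \<in> overlap\<^sup>*"
proof -
  have chain: "(Ss ! 0, Ss ! i) \<in> overlap\<^sup>*" if "i < length Ss" for i
    using that
  proof (induction i)
    case (Suc i)
    then have "(Ss ! i, Ss ! Suc i) \<in> overlap"
      using assms(1) nth_mem by (fastforce simp: intersecting_seq_def overlap_def)
    with Suc show ?case by (auto intro: rtrancl_into_rtrancl)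
  qed simp
  obtain i j where "i < length Ss" "S = Ss ! i" "j < length Ss" "T = Ss ! j"
    using assms(2,3) by (metis in_set_conv_nth)
  then show ?thesis using chain[of i] chain[of j] sym_overlap_rtrancl rtrancl_trans by metis
qed

lemma overlap_intersecting_seq:
  assumes "(S, T) \<in> overlap\<^sup>*" "S \<in> far_components G A B"
  obtains Ss where "intersecting_seq G A B Ss" "S \<in> set Ss" "T \<in> set Ss"
proof -
  have "\<exists>Ss. intersecting_seq G A B Ss \<and> Ss \<noteq> [] \<and> S \<in> set Ss \<and> last Ss = T"
    using assms(1)
  proof (induction rule: rtrancl_induct)
    case base
    show ?case using assms(2) by (intro exI[of _ "[S]"]) (simp add: intersecting_seq_def)
  next
    case (step T U)
    then obtain Ss where Ss: "intersecting_seq G A B Ss" "Ss \<noteq> []" "S \<in> set Ss" "last Ss = T"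
      by blast
    have "nbhd G ((Ss @ [U]) ! i) \<inter> nbhd G ((Ss @ [U]) ! Suc i) \<noteq> {}"
      if i: "Suc i < length (Ss @ [U])" for i
    proof (cases "Suc i = length Ss")
      case True
      then have "Ss ! i = T" using Ss by (metis diff_Suc_1 last_conv_nth)
      then show ?thesis using True step.hyps(2) by (simp add: nth_append overlap_def)
    next
      case False
      then show ?thesis using i Ss(1) by (simp add: nth_append intersecting_seq_def)
    qed
    then have "intersecting_seq G A B (Ss @ [U])"
      using Ss(1) step.hyps(2) by (simp add: intersecting_seq_def overlap_def)
    then show ?case using Ss by (intro exI[of _ "Ss @ [U]"]) auto
  qed
  then show thesis using that last_in_set by blast
qed

lemma equiv_rel_iff:
  "(u, v) \<in> equiv_rel G A B \<longleftrightarrow> u \<in> verts G - (A \<union> B) \<and> v \<in> verts G - (A \<union> B) \<and>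
     (u = v \<or> (\<exists>S T. S \<in> far_components G A B \<and> T \<in> far_components G A B \<and>
        u \<in> closed_nbhd G S \<and> v \<in> closed_nbhd G T \<and> (S, T) \<in> overlap\<^sup>*))"
  (is "_ \<longleftrightarrow> _ \<and> _ \<and> (_ \<or> ?R)")
proof -
  have "(\<exists>Ss. intersecting_seq G A B Ss \<and> belongs_to G u Ss \<and> belongs_to G v Ss) \<longleftrightarrow> ?R"
    (is "?L \<longleftrightarrow> _")
  proof
    assume ?L
    then obtain Ss S T where "intersecting_seq G A B Ss" "S \<in> set Ss" "T \<in> set Ss"
      "u \<in> closed_nbhd G S" "v \<in> closed_nbhd G T"
      by (auto simp: belongs_to_def)
    moreover from this have "S \<in> far_components G A B" "T \<in> far_components G A B"
      by (auto simp: intersecting_seq_def)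
    ultimately show ?R using intersecting_seq_overlap by blast
  next
    assume ?R
    then obtain S T where ST: "S \<in> far_components G A B" "u \<in> closed_nbhd G S"
      "v \<in> closed_nbhd G T" "(S, T) \<in> overlap\<^sup>*" by blast
    from overlap_intersecting_seq[OF ST(4,1)] show ?L
      using ST(2,3) unfolding belongs_to_def by metis
  qed
  then show ?thesis by (simp add: equiv_rel_def)
qed

text \<open>A shared rim vertex lies in both neighbourhoods; any other shared vertex lies in both
  components, which are then equal. This joins two chains in the proof of transitivity.\<close>

lemma common_vertex_overlap:
  assumes "S \<in> far_components G A B" "T \<in> far_components G A B"
    and "v \<in> closed_nbhd G S" "v \<in> closed_nbhd G T"
  shows "(S, T) \<in> overlap\<^sup>*"
proof (cases "v \<in> rim A B")
  case True
  then have "v \<in> nbhd G S \<inter> nbhd G T"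
    using assms far_componentD(2) unfolding closed_nbhd_def by blast
  then show ?thesis using assms by (auto simp: overlap_def)
next
  case False
  then have "v \<in> S" "v \<in> T"
    using assms far_component_nbhd unfolding closed_nbhd_def by blast+
  then show ?thesis using far_component_unique assms by blast
qed

lemma equiv_rel_equiv: "equiv (verts G - (A \<union> B)) (equiv_rel G A B)"
proof (rule equivI)
  show "equiv_rel G A B \<subseteq> (verts G - (A \<union> B)) \<times> (verts G - (A \<union> B))"
    by (auto simp: equiv_rel_def)
  show "refl_on (verts G - (A \<union> B)) (equiv_rel G A B)"
    by (auto simp: equiv_rel_def refl_on_def)
  show "sym (equiv_rel G A B)"
    by (auto simp: equiv_rel_def sym_def)
  show "trans (equiv_rel G A B)"
  proof (rule transI)
    fix u v w
    assume uv: "(u, v) \<in> equiv_rel G A B" and vw: "(v, w) \<in> equiv_rel G A B"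
    show "(u, w) \<in> equiv_rel G A B"
    proof (cases "u = v \<or> v = w")
      case False
      obtain S T where S: "S \<in> far_components G A B" "T \<in> far_components G A B"
        "u \<in> closed_nbhd G S" "v \<in> closed_nbhd G T" "(S, T) \<in> overlap\<^sup>*"
        using uv False unfolding equiv_rel_iff by blast
      obtain S' T' where T: "S' \<in> far_components G A B" "T' \<in> far_components G A B"
        "v \<in> closed_nbhd G S'" "w \<in> closed_nbhd G T'" "(S', T') \<in> overlap\<^sup>*"
        using vw False unfolding equiv_rel_iff by blast
      have "(S, T') \<in> overlap\<^sup>*"
        using S T common_vertex_overlap[of T S' v] rtrancl_trans by metis
      then show ?thesis using uv vw S T unfolding equiv_rel_iff by blast
    qed (use uv vw in blast)
  qed
qed

lemma equiv_class_eq_iff: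
  assumes "u \<in> verts G - (A \<union> B)" "v \<in> verts G - (A \<union> B)"
  shows "equiv_class G A B u = equiv_class G A B v \<longleftrightarrow> (u, v) \<in> equiv_rel G A B"
  unfolding equiv_class_def using eq_equiv_class_iff[OF equiv_rel_equiv assms] .

text \<open>It yields the hypothesis \<open>far\<close> of \<open>mono_convex_side\<close> for every
  colouring constant on classes.\<close>

lemma far_adj_equiv_rel:
  assumes "s \<in> verts G - (A \<union> B)" "s \<notin> rim A B" "t \<in> verts G - (A \<union> B)" "s \<rightarrow> t"
  shows "(s, t) \<in> equiv_rel G A B"
proof -
  obtain S where S: "S \<in> far_components G A B" "s \<in> S"
    using far_component_exists assms by blast
  then have "s \<in> closed_nbhd G S" "t \<in> closed_nbhd G S"
    using assms adj_sym by (auto simp: closed_nbhd_def nbhd_def)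
  then show ?thesis using S assms unfolding equiv_rel_iff by blast
qed

subsection \<open>Separating half-spaces\<close>

text \<open>A chordless path from \<open>s\<close> through \<open>S\<close> to \<open>m\<close> is
  prolonged by the end \<open>a\<close> of a linking edge, which sees \<open>m\<close> but no vertex
  of \<open>S\<close>. Both ends lie in \<open>H\<close>, hence so does \<open>m\<close>.\<close>

lemma far_component_side:
  assumes H: "mono_convex G H" "A \<subseteq> H"
    and S: "S \<in> far_components G A B" "s \<in> S" "m \<in> nbhd G S" and "s \<in> H"
  shows "m \<in> H"
proof -
  obtain a b where ab: "a \<in> A" "b \<in> B" "a \<rightarrow> b" using linked by (auto simp: linked_def)
  have m: "m \<in> rim A B" using S far_component_nbhd by blast
  obtain t where t: "t \<in> S" "t \<rightarrow> m" using S(3) adj_sym by (auto simp: nbhd_def)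
  let ?X = "insert m S"
  have "(s, t) \<in> (Restr (arcs_ends G) ?X)\<^sup>*"
    using far_componentD(4)[OF S(1,2) t(1)]
      rtrancl_mono[of "Restr (arcs_ends G) S" "Restr (arcs_ends G) ?X"] by blast
  moreover have "(t, m) \<in> Restr (arcs_ends G) ?X" using t by blast
  ultimately have "(s, m) \<in> (Restr (arcs_ends G) ?X)\<^sup>*" by (rule rtrancl_into_rtrancl)
  moreover have "s \<in> verts G" using S far_componentD(2) by blast
  ultimately obtain p where p: "induced_path p" "hd p = s" "last p = m" "set p \<subseteq> ?X"
    using induced_path_of_walk S(2) by (metis insertCI)
  have ne: "p \<noteq> []" "distinct p" using p(1) by (auto simp: induced_path_def)
  have "set (butlast p) \<subseteq> S"
  proof
    fix x assume x: "x \<in> set (butlast p)"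
    have "p = butlast p @ [m]" using ne p(3) by (metis append_butlast_last_id)
    then have "x \<noteq> m" using ne x by (metis distinct_append disjoint_iff list.set_intros(1))
    then show "x \<in> S" using x p(4) in_set_butlastD by fastforce
  qed
  then have far: "\<not> x \<rightarrow> a" if "x \<in> set (butlast p)" for x
    using that far_componentD(2)[OF S(1)] rimI[of a A x B] ab adj_sym by blast
  have "a \<notin> set p" using p(4) far_componentD(2)[OF S(1)] m rimD ab by blast
  then have "induced_path (p @ [a])"
    using induced_path_snoc p far rim_adj(1)[OF m ab] by blast
  from mono_convexD[OF H(1) this] have "set (p @ [a]) \<subseteq> H"
    using p ne H(2) ab \<open>s \<in> H\<close> by auto
  then show "m \<in> H" using p ne last_in_set by fastforce
qed

text \<open>\<open>far_component_side\<close> applies to \<open>H\<close> and, with the sides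
  exchanged, to its complement; shared neighbours carry the side along a chain of
  components.\<close>

lemma half_space_equiv_rel:
  assumes H: "half_space G H" "A \<subseteq> H" "B \<subseteq> verts G - H"
    and uv: "(u, v) \<in> equiv_rel G A B"
  shows "u \<in> H \<longleftrightarrow> v \<in> H"
proof -
  have nbhd: "s \<in> H \<longleftrightarrow> m \<in> H" if S: "S \<in> far_components G A B" "s \<in> S" "m \<in> nbhd G S" for S s m
  proof
    show "s \<in> H \<Longrightarrow> m \<in> H" using far_component_side S H by (auto simp: half_space_def)
    have "s \<in> verts G - H \<Longrightarrow> m \<in> verts G - H"
      using saturated_pair.far_component_side[OF swap, of "verts G - H" S s m] S H
        far_components_commute[of G B A]
      by (auto simp: half_space_def)
    moreover have "s \<in> verts G" using far_componentD(2)[OF S(1)] S(2) by blast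
    ultimately show "m \<in> H \<Longrightarrow> s \<in> H" by blast
  qed
  have same: "x \<in> H \<longleftrightarrow> m \<in> H"
    if S: "S \<in> far_components G A B" "x \<in> closed_nbhd G S" "m \<in> nbhd G S" for S x m
  proof (cases "x \<in> S")
    case False
    obtain s where "s \<in> S" using far_componentD(1)[OF S(1)] by blast
    then show ?thesis using nbhd[OF S(1)] S False unfolding closed_nbhd_def by blast
  qed (use nbhd S in blast)
  \<comment> \<open>Both vertices are compared with one vertex of \<open>nbhd G S\<close>, which is
    nonempty by connectedness.\<close>
  have comp: "x \<in> H \<longleftrightarrow> y \<in> H"
    if S: "S \<in> far_components G A B" "x \<in> closed_nbhd G S" "y \<in> closed_nbhd G S" for S x y
    using far_component_nbhd_nonempty[OF S(1)] same[OF S(1)] S(2,3) by blast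
  show ?thesis
  proof (cases "u = v")
    case False
    then obtain S T where ST: "S \<in> far_components G A B" "T \<in> far_components G A B"
      "u \<in> closed_nbhd G S" "v \<in> closed_nbhd G T" "(S, T) \<in> overlap\<^sup>*"
      using uv unfolding equiv_rel_iff by blast
    \<comment> \<open>\<open>v\<close> is generalized because the induction hypothesis is applied to
      the vertex \<open>m\<close> shared by consecutive neighbourhoods.\<close>
    from ST(5,2,4) show ?thesis
    proof (induction arbitrary: v rule: rtrancl_induct)
      case base
      then show ?case using comp ST by blast
    next
      case (step T U)
      then obtain m where m: "T \<in> far_components G A B" "m \<in> nbhd G T" "m \<in> nbhd G U"
        by (auto simp: overlap_def)
      then show ?case using step.IH[of m] step.prems comp[of U m v]
        unfolding closed_nbhd_def by blast
    qed
  qed simp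
qed

text \<open>If both vertices lay on one side, their hull would stay there and miss \<open>A\<close>
  or \<open>B\<close>.\<close>

lemma half_space_mfs:
  assumes H: "half_space G H" "A \<subseteq> H" "B \<subseteq> verts G - H" and uv: "{u, v} \<in> mfs G A B"
  shows "u \<in> H \<longleftrightarrow> v \<notin> H"
proof -
  have f: "u \<in> verts G" "v \<in> verts G" "cl G {u, v} \<inter> A \<noteq> {}" "cl G {u, v} \<inter> B \<noteq> {}"
    using uv by (auto simp: mfs_def forbidden_def)
  have "\<not> {u, v} \<subseteq> H"
    using f H cl_minimal[of "{u, v}" H] by (auto simp: half_space_def)
  moreover have "\<not> {u, v} \<subseteq> verts G - H"
    using f H cl_minimal[of "{u, v}" "verts G - H"] by (auto simp: half_space_def)
  ultimately show ?thesis using f by blast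
qed

text \<open>Each class lies on one side of \<open>H\<close>, so the side of a representative is a
  2-colouring; it is proper because forbidden pairs are split.\<close>

lemma separable_imp_bipartite:
  assumes H: "half_space G H" "A \<subseteq> H" "B \<subseteq> verts G - H"
  shows "bipartite (with_proj (quotient_graph G A B))"
proof -
  let ?U = "equiv_class G A B ` ((verts G - (A \<union> B)) \<inter> H)"
  let ?W = "equiv_class G A B ` (verts G - (A \<union> B) - H)"
  have "pverts (quotient_graph G A B) = ?U \<union> ?W"
    by (auto simp: quotient_graph_def quotient_def equiv_class_def)
  moreover have "?U \<inter> ?W = {}"
    using half_space_equiv_rel[OF H] equiv_class_eq_iff by fastforce
  moreover have "x \<in> ?U \<and> y \<in> ?W \<or> x \<in> ?W \<and> y \<in> ?U"
    if "(x, y) \<in> parcs (quotient_graph G A B)" for x y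
    using that half_space_mfs[OF H] by (fastforce simp: quotient_graph_def)
  ultimately show ?thesis unfolding bipartite_def with_proj_simps by blast
qed

section \<open>Half-spaces from colourings\<close>

text \<open>\<open>mono_convex_side\<close> is used for \<open>P\<close> with \<open>A\<close> and
  for its negation with \<open>B\<close>; the two convex sets are complementary.\<close>

lemma colouring_imp_separable:
  assumes equiv: "\<And>u v. (u, v) \<in> equiv_rel G A B \<Longrightarrow> P u \<longleftrightarrow> P v"
    and rim: "\<And>m m'. \<lbrakk>m \<in> rim A B; m' \<in> rim A B; m \<noteq> m'; \<not> m \<rightarrow> m'\<rbrakk> \<Longrightarrow> P m \<longleftrightarrow> \<not> P m'"
    and adj_A: "\<And>x m m'. \<lbrakk>m \<in> rim A B; m' \<in> rim A B; \<not> P m; P m'; x \<in> A; x \<rightarrow> m\<rbrakk> \<Longrightarrow> x \<rightarrow> m'"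
    and adj_B: "\<And>x m m'. \<lbrakk>m \<in> rim A B; m' \<in> rim A B; P m; \<not> P m'; x \<in> B; x \<rightarrow> m\<rbrakk> \<Longrightarrow> x \<rightarrow> m'"
  shows "separable G A B"
proof -
  let ?R = "verts G - (A \<union> B)"
  have "mono_convex G (A \<union> {v \<in> ?R. P v})"
    by (rule mono_convex_side) (use equiv far_adj_equiv_rel rim adj_A in blast)+
  moreover have "mono_convex G (B \<union> {v \<in> verts G - (B \<union> A). \<not> P v})"
    by (rule saturated_pair.mono_convex_side[OF swap], unfold rim_commute Un_commute[of B A])
      (use equiv far_adj_equiv_rel rim adj_B in blast)+
  moreover have "verts G - (A \<union> {v \<in> ?R. P v}) = B \<union> {v \<in> verts G - (B \<union> A). \<not> P v}"
    using B_verts disjoint by blast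
  ultimately show ?thesis
    unfolding separable_def half_space_def by (metis Un_upper1)
qed

lemma bipartite_imp_separable:
  assumes classes: "\<And>v x y. \<lbrakk>v \<in> verts G - (A \<union> B); x \<in> equiv_class G A B v;
      y \<in> equiv_class G A B v\<rbrakk> \<Longrightarrow> {x, y} \<notin> mfs G A B"
    and bip: "bipartite (with_proj (quotient_graph G A B))"
  shows "separable G A B"
proof (cases "\<exists>m\<in>rim A B. \<exists>m'\<in>rim A B. m \<noteq> m' \<and> \<not> m \<rightarrow> m'")
  \<comment> \<open>The rim is a clique: the constant colouring puts all outside vertices with
    \<open>A\<close>, and the hypotheses about two colours hold vacuously.\<close>
  case False
  show ?thesis
    by (rule colouring_imp_separable[of "\<lambda>_. True"]) (use False in blast)+
next
  case True
  then obtain m m' where m: "m \<in> rim A B" "m' \<in> rim A B" "m \<noteq> m'" "\<not> m \<rightarrow> m'" by blast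
  obtain U W where UW: "U \<inter> W = {}"
    "\<And>x y. (x, y) \<in> parcs (quotient_graph G A B) \<Longrightarrow> x \<in> U \<and> y \<in> W \<or> x \<in> W \<and> y \<in> U"
    using bip unfolding bipartite_def with_proj_simps by blast
  show ?thesis
  proof (rule colouring_imp_separable[of "\<lambda>v. equiv_class G A B v \<in> U"])
    show "equiv_class G A B u \<in> U \<longleftrightarrow> equiv_class G A B v \<in> U"
      if "(u, v) \<in> equiv_rel G A B" for u v
    proof -
      have "u \<in> verts G - (A \<union> B)" "v \<in> verts G - (A \<union> B)" using that equiv_rel_iff by blast+
      then show ?thesis using that equiv_class_eq_iff by metis
    qed
    show "equiv_class G A B u \<in> U \<longleftrightarrow> \<not> equiv_class G A B v \<in> U"
      if uv: "u \<in> rim A B" "v \<in> rim A B" "u \<noteq> v" "\<not> u \<rightarrow> v" for u v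
    proof -
      have mfs: "{u, v} \<in> mfs G A B" using nonadjacent_rim_mfs uv by blast
      have R: "u \<in> verts G - (A \<union> B)" "v \<in> verts G - (A \<union> B)"
        using rimD uv by blast+
      have "u \<in> equiv_class G A B u" using R by (simp add: equiv_class_def equiv_rel_iff)
      \<comment> \<open>The condition on classes forces a forbidden pair into two classes, which are
        therefore adjacent in the quotient and coloured differently.\<close>
      then have "(u, v) \<notin> equiv_rel G A B"
        using classes[OF R(1), of u v] mfs by (auto simp: equiv_class_def)
      then have "(equiv_class G A B u, equiv_class G A B v) \<in> parcs (quotient_graph G A B)"
        using R mfs by (auto simp: quotient_graph_def)
      then show ?thesis using UW by blast
    qed
    \<comment> \<open>The nonadjacent pair \<open>m\<close>, \<open>m'\<close> makes all rim
      vertices agree on their neighbours in \<open>A\<close>, whatever their colours; likewise for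
      \<open>B\<close> below.\<close>
    show "x \<rightarrow> v" if "u \<in> rim A B" "v \<in> rim A B" "x \<in> A" "x \<rightarrow> u" for x u v
      using that nonadjacent_rim_adj_A_iff[OF m] by blast
    show "x \<rightarrow> v" if "u \<in> rim A B" "v \<in> rim A B" "x \<in> B" "x \<rightarrow> u" for x u v
      using that saturated_pair.nonadjacent_rim_adj_A_iff[OF swap, of m m'] m rim_commute
      by metis
  qed
qed

end

theorem theorem25:
  fixes G :: "('a, 'b) pre_digraph" and A B :: "'a set"
  assumes "pseudo_graph G" and "loopfree_digraph G" and "connected G"
    and "A \<subseteq> verts G" and "B \<subseteq> verts G"
    and "A \<inter> B = {}" and "linked G A B" and "saturated G A B"
  shows "separable G A B \<longleftrightarrow>
    (\<forall>v \<in> verts G - (A \<union> B).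
       \<not> (\<exists>x \<in> equiv_class G A B v. \<exists>y \<in> equiv_class G A B v. {x, y} \<in> mfs G A B)) \<and>
    bipartite (with_proj (quotient_graph G A B))"
proof -
  interpret undirected_graph G
    using assms(1,2) by (rule undirected_graph.intro)
  have "saturated G B A" using assms(8) by (simp add: saturated_def)
  then interpret saturated_pair G A B
    using assms saturated_presaturation by unfold_locales blast+
  show ?thesis
  proof
    assume "separable G A B"
    then obtain H where H: "half_space G H" "A \<subseteq> H" "B \<subseteq> verts G - H"
      by (auto simp: separable_def)
    have "{x, y} \<notin> mfs G A B"
      if "x \<in> equiv_class G A B v" "y \<in> equiv_class G A B v" for v x y
      using that half_space_equiv_rel[OF H] half_space_mfs[OF H, of x y]
      by (auto simp: equiv_class_def)
    then show "(\<forall>v \<in> verts G - (A \<union> B).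
         \<not> (\<exists>x \<in> equiv_class G A B v. \<exists>y \<in> equiv_class G A B v. {x, y} \<in> mfs G A B)) \<and>
      bipartite (with_proj (quotient_graph G A B))"
      using separable_imp_bipartite[OF H] by blast
  qed (use bipartite_imp_separable in blast)
qed

end
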